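(* Let $\mathcal A=(A_n)_{n\ge1}$ be a sequence of nonnegative $d\times d$ matrices such that $P_n\ne0$ for all $n$. Suppose there exist an increasing sequence of positive integers $(s_k)_{k\ge1}$ for which the limit $P^{(s)}:=\lim_{k\to\infty}\frac{P_{s_k}}{\Vert P_{s_k}\Vert}$ exists, and such that the following two conditions hold. (1) $\displaystyle\inf\Big\{\frac{\Vert P_n\Vert}{\Vert P_{s_k}\Vert\,\Vert P_{s_k,n}\Vert}\;:\;k,n\text{ such that }s_{k+1}\le n<s_{k+2}\Big\}>0.$ (2) Setting $J=\{j\;:\;P^{(s)}u_j\ne0\}$, there exists a limit-point $Q=(q_{i,j})_{i,j}$ of the sequence $k\mapsto\frac{P_{s_k,s_{k+1}}}{\Vert P_{s_k,s_{k+1}}\Vert}$ such that for all $j,j'\in J$ there exists $i\in J$ with $q_{i,j}\,q_{i,j'}\ne0$. Then the sequence $\frac{P_nc}{\Vert P_nc\Vert}$ converges for any positive column-vector $c$, and more generally for any $c\in\mathcal V_{\mathcal A}:=\{v\text{ nonnegative column-vector}\;:\;\inf_n\frac{\Vert P_nv\Vert}{\Vert P_n\Vert}>0\}$. The limit does not depend on $c$.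
   Context: A matrix or vector is nonnegative (resp. positive) if all its entries are $\ge0$ (resp. $>0$). $\Vert X\Vert$ denotes the sum of the absolute values of the entries of the matrix or vector $X$. For a sequence of $d\times d$ matrices $(A_n)_{n\ge1}$ set $P_n:=A_1\cdots A_n$, $P_{m,n}:=A_{m+1}\cdots A_n$ for $n>m\ge0$, and $P_0=P_{n,n}:=I_d$. The vectors $u_1,\dots,u_d$ are the canonical $d$-dimensional column-vectors. A limit-point of a sequence is the limit of one of its subsequences. *)

theory Defs
  imports "HOL-Analysis.Analysis"
begin

text \<open>Nonnegativity and positivity are entrywise. The library order on \<open>real ^ 'd\<close> agrees with this
  for \<open>\<le>\<close>, but its \<open><\<close> is not entrywise, so the notions are spelled out here.\<close>

definition nonneg_mat :: "real ^ 'n ^ 'm \<Rightarrow> bool" where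
  "nonneg_mat X \<longleftrightarrow> (\<forall>i j. 0 \<le> X $ i $ j)"

definition nonneg_vec :: "real ^ 'n \<Rightarrow> bool" where
  "nonneg_vec v \<longleftrightarrow> (\<forall>i. 0 \<le> v $ i)"

definition pos_vec :: "real ^ 'n \<Rightarrow> bool" where
  "pos_vec v \<longleftrightarrow> (\<forall>i. 0 < v $ i)"

text \<open>The norm is the sum of the absolute values of the entries, not the Euclidean \<open>norm\<close>.\<close>

definition mnorm :: "real ^ 'n ^ 'm \<Rightarrow> real" where
  "mnorm X = (\<Sum>i\<in>UNIV. \<Sum>j\<in>UNIV. \<bar>X $ i $ j\<bar>)"

definition vnorm :: "real ^ 'n \<Rightarrow> real" where
  "vnorm v = (\<Sum>i\<in>UNIV. \<bar>v $ i\<bar>)"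

text \<open>\<open>mprod A m n\<close> is $P_{m,n} = A_{m+1} \cdots A_n$ for \<open>m < n\<close> and the identity for \<open>m = n\<close>
  (and, as a junk value, for \<open>m > n\<close>). Sequences of matrices are indexed from 1, so that \<open>A 0\<close> is
  never used.\<close>

primrec mprod :: "(nat \<Rightarrow> real ^ 'd ^ 'd) \<Rightarrow> nat \<Rightarrow> nat \<Rightarrow> real ^ 'd ^ 'd" where
  "mprod A m 0 = mat 1"
| "mprod A m (Suc n) = (if m \<le> n then mprod A m n ** A (Suc n) else mat 1)"

abbreviation pprod :: "(nat \<Rightarrow> real ^ 'd ^ 'd) \<Rightarrow> nat \<Rightarrow> real ^ 'd ^ 'd" where
  "pprod A n \<equiv> mprod A 0 n"

definition seq_limit_point :: "(nat \<Rightarrow> 'a::topological_space) \<Rightarrow> 'a \<Rightarrow> bool" where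
  "seq_limit_point X Q \<longleftrightarrow> (\<exists>r. strict_mono r \<and> (\<lambda>k. X (r k)) \<longlonglongrightarrow> Q)"

definition V_set :: "(nat \<Rightarrow> real ^ 'd ^ 'd) \<Rightarrow> (real ^ 'd) set" where
  "V_set A = {v. nonneg_vec v \<and>
     (INF n\<in>{1..}. vnorm (pprod A n *v v) / mnorm (pprod A n)) > 0}"

end

theory Submission imports Defs begin

text \<open>Write $X_k = P_{s_k}/\Vert P_{s_k}\Vert$. Passing to the limit in
  $P_{s_{k+1}} = P_{s_k} P_{s_k,s_{k+1}}$ along the subsequence that yields $Q$ gives
  $P^{(s)} Q = \theta P^{(s)}$, where $\theta > 0$ by (1). Hence each normalized nonzero column of
  $P^{(s)}$ is a convex combination of the normalized nonzero columns, and by the maximum principle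
  the overlap condition (2) makes all of them equal to one vector $L$. If $s_{k+1} \le n < s_{k+2}$,
  then $P_n c / \Vert P_n c\Vert = X_k z$ with $z \ge 0$ bounded uniformly in $n$, again by (1), and
  $X_k z$ is close to $P^{(s)} z$, which is a nonnegative multiple of $L$.\<close>

section \<open>Entry-sum norms and products of nonnegative matrices\<close>

lemma vnorm_nonneg: "0 \<le> vnorm v"
  unfolding vnorm_def by (simp add: sum_nonneg)

lemma vnorm_eq_0_iff: "vnorm v = 0 \<longleftrightarrow> v = 0"
  by (simp add: vnorm_def sum_nonneg_eq_0_iff vec_eq_iff)

lemma vnorm_scaleR: "vnorm (a *\<^sub>R v) = \<bar>a\<bar> * vnorm v"
  by (simp add: vnorm_def abs_mult sum_distrib_left)

lemma vnorm_minus_commute: "vnorm (v - w) = vnorm (w - v)"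
  by (simp add: vnorm_def abs_minus_commute)

lemma vnorm_triangle: "vnorm (v + w) \<le> vnorm v + vnorm w"
  unfolding vnorm_def sum.distrib[symmetric] by (rule sum_mono) (simp add: abs_triangle_ineq)

lemma mnorm_nonneg: "0 \<le> mnorm M"
  unfolding mnorm_def by (simp add: sum_nonneg)

lemma mnorm_eq_0_iff: "mnorm M = 0 \<longleftrightarrow> M = 0"
  by (simp add: mnorm_def sum_nonneg_eq_0_iff sum_nonneg vec_eq_iff)

lemma mnorm_scaleR: "mnorm (a *\<^sub>R M) = \<bar>a\<bar> * mnorm M"
  by (simp add: mnorm_def abs_mult sum_distrib_left)

lemma tendsto_mnorm:
  assumes "(X \<longlongrightarrow> M) F"
  shows "((\<lambda>k. mnorm (X k)) \<longlongrightarrow> mnorm M) F"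
  unfolding mnorm_def by (intro tendsto_intros assms)

lemma tendsto_matrix_mult:
  fixes X :: "'a \<Rightarrow> real ^ 'n ^ 'm" and Y :: "'a \<Rightarrow> real ^ 'p ^ 'n"
  assumes "(X \<longlongrightarrow> M) F" "(Y \<longlongrightarrow> N) F"
  shows "((\<lambda>k. X k ** Y k) \<longlongrightarrow> M ** N) F"
  unfolding matrix_matrix_mult_def by (intro tendsto_intros assms)

lemma scaleR_matrix_vector_mult:
  fixes M :: "real ^ 'n ^ 'm"
  shows "(a *\<^sub>R M) *v v = a *\<^sub>R (M *v v)"
  by (simp add: vec_eq_iff matrix_vector_mult_def sum_distrib_left mult.assoc)

lemma scaleR_matrix_mult_scaleR:
  fixes M :: "real ^ 'n ^ 'm" and N :: "real ^ 'p ^ 'n"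
  shows "(a *\<^sub>R M) ** (b *\<^sub>R N) = (a * b) *\<^sub>R (M ** N)"
  by (simp add: vec_eq_iff matrix_matrix_mult_def sum_distrib_left mult_ac)

lemma vnorm_matrix_vector_mult_le:
  fixes M :: "real ^ 'n ^ 'm"
  shows "vnorm (M *v v) \<le> mnorm M * vnorm v"
proof -
  have "vnorm (M *v v) \<le> (\<Sum>i\<in>UNIV. \<Sum>j\<in>UNIV. \<bar>M $ i $ j\<bar> * vnorm v)"
    unfolding vnorm_def[of "M *v v"]
  proof (rule sum_mono)
    fix i :: 'm
    have "\<bar>v $ j\<bar> \<le> vnorm v" for j
      unfolding vnorm_def by (rule member_le_sum) auto
    then have "(\<Sum>j\<in>UNIV. \<bar>M $ i $ j * v $ j\<bar>) \<le> (\<Sum>j\<in>UNIV. \<bar>M $ i $ j\<bar> * vnorm v)"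
      by (intro sum_mono) (simp add: abs_mult mult_left_mono)
    then show "\<bar>(M *v v) $ i\<bar> \<le> (\<Sum>j\<in>UNIV. \<bar>M $ i $ j\<bar> * vnorm v)"
      using order_trans[OF sum_abs] by (simp add: matrix_vector_mult_def)
  qed
  then show ?thesis
    by (simp add: mnorm_def sum_distrib_right)
qed

lemma nonneg_mat_mult:
  assumes "nonneg_mat M" "nonneg_mat N"
  shows "nonneg_mat (M ** N)"
  using assms by (auto simp: nonneg_mat_def matrix_matrix_mult_def intro!: sum_nonneg)

lemma nonneg_vec_matrix_vector_mult:
  assumes "nonneg_mat M" "nonneg_vec v"
  shows "nonneg_vec (M *v v)"
  using assms by (auto simp: nonneg_mat_def nonneg_vec_def matrix_vector_mult_def intro!: sum_nonneg)

lemma nonneg_mat_mprod: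
  assumes "\<And>n. n \<ge> 1 \<Longrightarrow> nonneg_mat (A n)"
  shows "nonneg_mat (mprod A m n)"
  by (induction n) (simp_all add: nonneg_mat_mult assms, simp_all add: nonneg_mat_def mat_def)

lemma mprod_self: "mprod A m m = mat 1"
  by (cases m) simp_all

lemma mprod_append:
  assumes "l \<le> m" "m \<le> n"
  shows "mprod A l n = mprod A l m ** mprod A m n"
  using assms(2)
proof (induction n rule: dec_induct)
  case base
  then show ?case by (simp add: mprod_self)
next
  case (step n)
  then show ?case using assms(1) by (simp add: matrix_mul_assoc)
qed

section \<open>Proportionality of the columns of the limit matrix\<close>

lemma vnorm_column:
  fixes M :: "real ^ 'n ^ 'm"
  assumes "nonneg_mat M"
  shows "vnorm (M *v axis j 1) = (\<Sum>i\<in>UNIV. M $ i $ j)"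
proof -
  have "(M *v axis j 1) $ i = M $ i $ j" for i
    by (simp add: matrix_vector_mult_basis column_def)
  then show ?thesis
    using assms by (simp add: vnorm_def nonneg_mat_def)
qed

text \<open>In a fixed row, each normalized entry in a column j of J is an average of the normalized
  entries, with weights proportional to \<open>p l * Q $ l $ j\<close>. Where the row is maximal,
  every column of positive weight attains the maximum, and likewise for the minimum;
  \<open>overlap\<close> supplies a column attaining both. The explicit coefficient of L in the
  conclusion is visibly nonnegative for nonnegative v.\<close>

lemma rank_one_of_overlapping:
  fixes P Q :: "real ^ 'd ^ 'd"
  assumes P: "nonneg_mat P" and Q: "nonneg_mat Q" and "\<theta> > 0" and PQ: "P ** Q = \<theta> *\<^sub>R P"
    and J: "J = {j. P *v axis j 1 \<noteq> 0}"
    and overlap: "\<And>j j'. j \<in> J \<Longrightarrow> j' \<in> J \<Longrightarrow> \<exists>i\<in>J. Q $ i $ j * Q $ i $ j' \<noteq> 0"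
    and "P \<noteq> 0"
  shows "\<exists>L. vnorm L = 1 \<and> (\<forall>v. P *v v = (\<Sum>j\<in>UNIV. vnorm (P *v axis j 1) * v $ j) *\<^sub>R L)"
proof -
  define p where "p j = vnorm (P *v axis j 1)" for j
  define f where "f i j = P $ i $ j / p j" for i j
  have p_eq: "p j = (\<Sum>i\<in>UNIV. P $ i $ j)" for j
    unfolding p_def by (rule vnorm_column[OF P])
  have J_iff: "j \<in> J \<longleftrightarrow> p j \<noteq> 0" for j
    by (simp add: J p_def vnorm_eq_0_iff)
  have p_pos: "p j > 0" if "j \<in> J" for j
    using that J_iff[of j] vnorm_nonneg[of "P *v axis j 1"] by (simp add: p_def)
  \<comment> \<open>If \<open>p j = 0\<close>, then \<open>f i j\<close> is 0 by the convention for
    division, and column j vanishes as well, so the factorization covers every j.\<close>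
  have P_entry: "P $ i $ j = p j * f i j" for i j
  proof (cases "p j = 0")
    case True
    then have "P *v axis j 1 = 0" by (simp add: p_def vnorm_eq_0_iff)
    moreover have "(P *v axis j 1) $ i = P $ i $ j"
      by (simp add: matrix_vector_mult_basis column_def)
    ultimately show ?thesis using True by simp
  qed (simp add: f_def)
  have PQ_entry: "(\<Sum>l\<in>UNIV. P $ i $ l * Q $ l $ j) = \<theta> * P $ i $ j" for i j
    using arg_cong[OF PQ, of "\<lambda>M. M $ i $ j"] by (simp add: matrix_matrix_mult_def)
  \<comment> \<open>Summing the relation over the rows turns entries into column sums: p is a left
    eigenvector of Q. This fixes the total weight of the averages below.\<close>
  have p_Q: "(\<Sum>l\<in>UNIV. p l * Q $ l $ j) = \<theta> * p j" for j
  proof -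
    have "(\<Sum>l\<in>UNIV. p l * Q $ l $ j) = (\<Sum>l\<in>UNIV. \<Sum>i\<in>UNIV. P $ i $ l * Q $ l $ j)"
      by (simp add: p_eq sum_distrib_right)
    also have "\<dots> = (\<Sum>i\<in>UNIV. \<theta> * P $ i $ j)"
      by (subst sum.swap) (simp add: PQ_entry)
    finally show ?thesis by (simp add: p_eq sum_distrib_left)
  qed
  \<comment> \<open>The averaging identity, with a free constant M so that it can be used at both
    the maximum and the minimum of a row.\<close>
  have average: "(\<Sum>l\<in>UNIV. p l * Q $ l $ j * (M - f i l)) = \<theta> * p j * (M - f i j)" for i j M
  proof -
    have "(\<Sum>l\<in>UNIV. p l * Q $ l $ j * (M - f i l))
      = M * (\<Sum>l\<in>UNIV. p l * Q $ l $ j) - (\<Sum>l\<in>UNIV. P $ i $ l * Q $ l $ j)"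
      by (simp add: P_entry sum_distrib_left sum_subtractf[symmetric] algebra_simps)
    also have "\<dots> = M * (\<theta> * p j) - \<theta> * (p j * f i j)"
      by (simp only: p_Q PQ_entry P_entry[of i j])
    finally show ?thesis
      by (simp add: algebra_simps)
  qed
  have nn: "0 \<le> p l * Q $ l $ j" for l j
    using Q by (simp add: p_def nonneg_mat_def vnorm_nonneg)
  have "J \<noteq> {}"
  proof
    assume "J = {}"
    then have "p j = 0" for j using J_iff by blast
    then have "P = 0" by (simp add: vec_eq_iff P_entry)
    with \<open>P \<noteq> 0\<close> show False by simp
  qed
  have const: "f i j = f i j'" if "j \<in> J" "j' \<in> J" for i j j'
  proof -
    have fin: "finite (f i ` J)" and ne: "f i ` J \<noteq> {}" using \<open>J \<noteq> {}\<close> by auto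
    obtain a where a: "a \<in> J" "f i a = Max (f i ` J)" using Max_in[OF fin ne] by auto
    obtain b where b: "b \<in> J" "f i b = Min (f i ` J)" using Min_in[OF fin ne] by auto
    have le_a: "f i l \<le> f i a" and ge_b: "f i b \<le> f i l" if "l \<in> J" for l
      using that a b by auto
    obtain l where l: "l \<in> J" "Q $ l $ a \<noteq> 0" "Q $ l $ b \<noteq> 0"
      using overlap[OF a(1) b(1)] by auto
    \<comment> \<open>For l' outside J the weight is 0; inside J, a is maximal. So all terms are
      nonnegative, while \<open>average\<close> with M = \<open>f i a\<close> makes their sum 0:
      each term vanishes.\<close>
    have "p l' * Q $ l' $ a * (f i a - f i l') \<ge> 0" for l'
      using nn[of l' a] le_a[of l'] J_iff[of l'] by (cases "l' \<in> J") auto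
    then have "p l * Q $ l $ a * (f i a - f i l) = 0"
      using average[of a "f i a" i] by (simp add: sum_nonneg_eq_0_iff)
    moreover have "p l' * Q $ l' $ b * (f i l' - f i b) \<ge> 0" for l'
      using nn[of l' b] ge_b[of l'] J_iff[of l'] by (cases "l' \<in> J") auto
    \<comment> \<open>The same argument at the minimum; \<open>average\<close> has the opposite sign
      there, hence the negated sum.\<close>
    then have "p l * Q $ l $ b * (f i l - f i b) = 0"
      using average[of b "f i b" i] sum_negf[of "\<lambda>l. p l * Q $ l $ b * (f i b - f i l)" UNIV]
      by (simp add: sum_nonneg_eq_0_iff flip: mult_minus_right)
    ultimately have "f i a = f i b"
      using l p_pos[OF l(1)] by auto
    then show ?thesis
      using le_a ge_b that by (metis order_antisym)
  qed
  obtain j0 where j0: "j0 \<in> J" using \<open>J \<noteq> {}\<close> by blast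
  \<comment> \<open>All normalized columns indexed by J agree by \<open>const\<close>, so any j0 in
    J gives the same vector.\<close>
  define L :: "real ^ 'd" where "L = (\<chi> i. f i j0)"
  have "vnorm L = (\<Sum>i\<in>UNIV. f i j0)"
    using P p_pos[OF j0] by (simp add: vnorm_def L_def f_def nonneg_mat_def)
  also have "\<dots> = 1"
    using p_pos[OF j0] by (simp add: f_def p_eq sum_divide_distrib[symmetric])
  finally have L_norm: "vnorm L = 1" .
  have entry: "P $ i $ j = p j * L $ i" for i j
    using const[OF _ j0, of j i] J_iff[of j] by (cases "j \<in> J") (auto simp: P_entry L_def)
  have "P *v v = (\<Sum>j\<in>UNIV. p j * v $ j) *\<^sub>R L" for v
    by (simp add: vec_eq_iff matrix_vector_mult_def entry sum_distrib_left mult_ac)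
  then show ?thesis
    using L_norm unfolding p_def by blast
qed

section \<open>Lower bounds for vectors in \<open>V_set\<close>\<close>

text \<open>The ratios are bounded below by 0, so their real infimum is a genuine lower bound and
  can serve as \<gamma>. Clearing the denominator gives the form used in the estimates.\<close>

lemma V_setE:
  assumes "c \<in> V_set A"
  obtains \<gamma> where "\<gamma> > 0" and "\<And>n. n \<ge> 1 \<Longrightarrow> \<gamma> * mnorm (pprod A n) \<le> vnorm (pprod A n *v c)"
proof -
  define g where "g n = vnorm (pprod A n *v c) / mnorm (pprod A n)" for n
  have pos: "(INF n\<in>{1..}. g n) > 0"
    using assms by (simp add: V_set_def g_def)
  have "bdd_below (g ` {1..})"
    by (rule bdd_belowI[of _ 0]) (auto simp: g_def vnorm_nonneg mnorm_nonneg)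
  then have le: "(INF n\<in>{1..}. g n) \<le> g n" if "n \<ge> 1" for n
    using that by (auto intro: cINF_lower)
  have "(INF n\<in>{1..}. g n) * mnorm (pprod A n) \<le> vnorm (pprod A n *v c)" if "n \<ge> 1" for n
  proof (cases "mnorm (pprod A n) = 0")
    case True
    then show ?thesis by (simp add: vnorm_nonneg)
  next
    case False
    then have "mnorm (pprod A n) > 0" using mnorm_nonneg[of "pprod A n"] by simp
    then show ?thesis using le[OF that] by (simp add: g_def pos_le_divide_eq)
  qed
  with pos that show thesis by blast
qed

text \<open>Without cancellation, replacing every entry of c by the smallest one, m, only lowers the
  norm of the image, and it leaves m times the norm of the product.\<close>

lemma pos_vec_in_V_set:
  fixes A :: "nat \<Rightarrow> real ^ 'd ^ 'd"
  assumes nonneg: "\<And>n. n \<ge> 1 \<Longrightarrow> nonneg_mat (A n)"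
    and nonzero: "\<And>n. n \<ge> 1 \<Longrightarrow> pprod A n \<noteq> 0"
    and c: "pos_vec c"
  shows "c \<in> V_set A"
proof -
  define m where "m = Min (range (($) c))"
  have m_pos: "m > 0" using c by (auto simp: m_def pos_vec_def)
  have m_le: "m \<le> c $ j" for j by (auto simp: m_def)
  have "m \<le> vnorm (pprod A n *v c) / mnorm (pprod A n)" if "n \<ge> 1" for n
  proof -
    let ?P = "pprod A n"
    have P: "0 \<le> ?P $ i $ j" for i j
      using nonneg_mat_mprod[OF nonneg] by (simp add: nonneg_mat_def)
    have "m * mnorm ?P = (\<Sum>i\<in>UNIV. \<Sum>j\<in>UNIV. ?P $ i $ j * m)"
      by (simp add: mnorm_def P sum_distrib_left mult.commute)
    also have "\<dots> \<le> (\<Sum>i\<in>UNIV. \<Sum>j\<in>UNIV. ?P $ i $ j * c $ j)"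
      by (intro sum_mono mult_left_mono m_le P)
    also have "\<dots> \<le> vnorm (?P *v c)"
      unfolding vnorm_def matrix_vector_mult_def by (rule sum_mono) simp
    finally have "m * mnorm ?P \<le> vnorm (?P *v c)" .
    moreover have "mnorm ?P > 0"
      using nonzero[OF that] mnorm_nonneg[of ?P] mnorm_eq_0_iff[of ?P] by simp
    ultimately show ?thesis by (simp add: pos_le_divide_eq)
  qed
  then have "m \<le> (INF n\<in>{1..}. vnorm (pprod A n *v c) / mnorm (pprod A n))"
    by (intro cINF_greatest) auto
  then show ?thesis
    using m_pos c by (auto simp: V_set_def nonneg_vec_def pos_vec_def less_imp_le)
qed

section \<open>Convergence of the normalized images\<close>

theorem theorem2p1:
  fixes A :: "nat \<Rightarrow> real ^ 'd ^ 'd"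
    and s :: "nat \<Rightarrow> nat"
    and Ps :: "real ^ 'd ^ 'd"
    and J :: "'d set"
  assumes nonneg: "\<And>n. n \<ge> 1 \<Longrightarrow> nonneg_mat (A n)"
    and nonzero: "\<And>n. n \<ge> 1 \<Longrightarrow> pprod A n \<noteq> 0"
    and s_incr: "strict_mono_on {1..} s"
    and s_pos: "\<And>k. k \<ge> 1 \<Longrightarrow> s k \<ge> 1"
    and Ps: "(\<lambda>k. pprod A (s k) /\<^sub>R mnorm (pprod A (s k))) \<longlonglongrightarrow> Ps"
    and cond1: "Inf {mnorm (pprod A n) / (mnorm (pprod A (s k)) * mnorm (mprod A (s k) n)) | k n.
                   k \<ge> 1 \<and> s (k + 1) \<le> n \<and> n < s (k + 2)} > 0"
    and J: "J = {j. Ps *v axis j 1 \<noteq> 0}"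
    and cond2: "\<exists>Q. seq_limit_point
                   (\<lambda>k. mprod A (s k) (s (k + 1)) /\<^sub>R mnorm (mprod A (s k) (s (k + 1)))) Q \<and>
                 (\<forall>j\<in>J. \<forall>j'\<in>J. \<exists>i\<in>J. Q $ i $ j * Q $ i $ j' \<noteq> 0)"
  shows "\<exists>L. (\<forall>c. pos_vec c \<longrightarrow>
                 (\<lambda>n. (pprod A n *v c) /\<^sub>R vnorm (pprod A n *v c)) \<longlonglongrightarrow> L) \<and>
             (\<forall>c\<in>V_set A.
                 (\<lambda>n. (pprod A n *v c) /\<^sub>R vnorm (pprod A n *v c)) \<longlonglongrightarrow> L)"
proof -
  define S where "S = {mnorm (pprod A n) / (mnorm (pprod A (s k)) * mnorm (mprod A (s k) n)) | k n.
                   k \<ge> 1 \<and> s (k + 1) \<le> n \<and> n < s (k + 2)}"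
  define \<delta> where "\<delta> = Inf S"
  define X where "X k = pprod A (s k) /\<^sub>R mnorm (pprod A (s k))" for k
  define T where "T k = mprod A (s k) (s (k + 1)) /\<^sub>R mnorm (mprod A (s k) (s (k + 1)))" for k
  have \<delta>_pos: "\<delta> > 0" using cond1 by (simp add: \<delta>_def S_def)
  have s_less: "s k < s l" if "1 \<le> k" "k < l" for k l
    using strict_mono_onD[OF s_incr, of k l] that by simp
  have P_nonneg: "nonneg_mat (mprod A m n)" for m n
    by (rule nonneg_mat_mprod[OF nonneg])
  have P_pos: "mnorm (pprod A n) > 0" if "n \<ge> 1" for n
    using nonzero[OF that] mnorm_nonneg[of "pprod A n"] mnorm_eq_0_iff[of "pprod A n"] by simp
  have split: "pprod A n = pprod A (s k) ** mprod A (s k) n"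
    if "k \<ge> 1" "s (k + 1) \<le> n" for k n
    using that s_less[of k "k + 1"] by (intro mprod_append) auto
  have R_pos: "mnorm (mprod A (s k) n) > 0" if "k \<ge> 1" "s (k + 1) \<le> n" for k n
  proof -
    have "n \<ge> 1" using that s_pos[of "k + 1"] by simp
    then have "mprod A (s k) n \<noteq> 0"
      using nonzero[of n] split[OF that] by auto
    then show ?thesis
      using mnorm_nonneg[of "mprod A (s k) n"] mnorm_eq_0_iff[of "mprod A (s k) n"] by simp
  qed
  have bdd: "bdd_below S"
    by (rule bdd_belowI[of _ 0]) (auto simp: S_def mnorm_nonneg)
  have lower: "\<delta> \<le> mnorm (pprod A n) / (mnorm (pprod A (s k)) * mnorm (mprod A (s k) n))"
    if "k \<ge> 1" "s (k + 1) \<le> n" "n < s (k + 2)" for k n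
    unfolding \<delta>_def by (rule cInf_lower[OF _ bdd]) (use that S_def in blast)
  have X_lim: "X \<longlonglongrightarrow> Ps" using Ps by (simp add: X_def[abs_def])
  obtain Q r where r: "strict_mono r" and T_lim: "(\<lambda>k. T (r k)) \<longlonglongrightarrow> Q"
    and overlap: "\<And>j j'. j \<in> J \<Longrightarrow> j' \<in> J \<Longrightarrow> \<exists>i\<in>J. Q $ i $ j * Q $ i $ j' \<noteq> 0"
    using cond2 by (auto simp: seq_limit_point_def T_def)
  \<comment> \<open>The assumptions on s start at index 1. A strictly increasing r satisfies
    \<open>k \<le> r k\<close>, so the subsequence stays in that range once k is at least 1.\<close>
  have r_ge: "r k \<ge> 1" if "k \<ge> 1" for k
    using seq_suble[OF r, of k] that by simp
  have Q_nonneg: "nonneg_mat Q"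
    unfolding nonneg_mat_def
  proof (intro allI)
    fix i j
    have "(\<lambda>k. T (r k) $ i $ j) \<longlonglongrightarrow> Q $ i $ j"
      by (intro tendsto_intros T_lim)
    moreover have "0 \<le> T k $ i $ j" for k
      using P_nonneg by (simp add: T_def nonneg_mat_def mnorm_nonneg)
    ultimately show "0 \<le> Q $ i $ j"
      by (intro LIMSEQ_le_const) auto
  qed
  have Ps_nonneg: "nonneg_mat Ps"
    unfolding nonneg_mat_def
  proof (intro allI)
    fix i j
    have "(\<lambda>k. X k $ i $ j) \<longlonglongrightarrow> Ps $ i $ j"
      by (intro tendsto_intros X_lim)
    moreover have "0 \<le> X k $ i $ j" for k
      using P_nonneg by (simp add: X_def nonneg_mat_def mnorm_nonneg)
    ultimately show "0 \<le> Ps $ i $ j"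
      by (intro LIMSEQ_le_const) auto
  qed
  have mnorm_X: "mnorm (X k) = 1" if "k \<ge> 1" for k
    using P_pos[OF s_pos[OF that]] by (simp add: X_def mnorm_scaleR)
  have "mnorm Ps = 1"
  proof (rule LIMSEQ_unique)
    show "(\<lambda>k. mnorm (X k)) \<longlonglongrightarrow> mnorm Ps" by (rule tendsto_mnorm[OF X_lim])
    show "(\<lambda>k. mnorm (X k)) \<longlonglongrightarrow> 1"
      by (rule tendsto_eventually) (auto simp: eventually_sequentially intro!: exI[of _ 1] mnorm_X)
  qed
  then have Ps_nonzero: "Ps \<noteq> 0" using mnorm_eq_0_iff[of Ps] by auto
  \<comment> \<open>This is the ratio of condition (1) at n = \<open>s (k + 1)\<close>, the left end
    of its block, so \<delta> bounds it below.\<close>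
  define \<theta> where "\<theta> k = mnorm (pprod A (s (k + 1))) / (mnorm (pprod A (s k)) * mnorm (mprod A (s k) (s (k + 1))))" for k
  have XT: "X k ** T k = \<theta> k *\<^sub>R X (k + 1)" if "k \<ge> 1" for k
    using split[OF that order_refl] P_pos[OF s_pos[of "k + 1"]]
    by (simp add: X_def T_def \<theta>_def scaleR_matrix_mult_scaleR field_simps)
  have \<theta>_ge: "\<delta> \<le> \<theta> k" if "k \<ge> 1" for k
    unfolding \<theta>_def using that s_less[of "k + 1" "k + 2"] by (intro lower) auto
  have XT_lim: "(\<lambda>k. X (r k) ** T (r k)) \<longlonglongrightarrow> Ps ** Q"
    using LIMSEQ_subseq_LIMSEQ[OF X_lim r] T_lim by (intro tendsto_matrix_mult) (simp_all add: o_def)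
  have \<theta>_eq: "mnorm (X (r k) ** T (r k)) = \<theta> (r k)" if "k \<ge> 1" for k
    using XT[OF r_ge[OF that]] \<theta>_ge[OF r_ge[OF that]] \<delta>_pos mnorm_X[of "r k + 1"]
    by (simp add: mnorm_scaleR)
  \<comment> \<open>Convergence of the scalars is read off from the matrices:
    \<open>X (r k + 1)\<close> has norm 1, so \<open>\<theta> (r k)\<close> is the norm of a
    convergent product.\<close>
  have \<theta>_lim: "(\<lambda>k. \<theta> (r k)) \<longlonglongrightarrow> mnorm (Ps ** Q)"
    by (rule Lim_transform_eventually[OF tendsto_mnorm[OF XT_lim]])
       (auto simp: eventually_sequentially \<theta>_eq intro!: exI[of _ 1])
  have "\<delta> \<le> mnorm (Ps ** Q)"
    by (rule LIMSEQ_le_const[OF \<theta>_lim]) (use \<theta>_ge r_ge in blast)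
  then have \<theta>_pos: "mnorm (Ps ** Q) > 0" using \<delta>_pos by simp
  \<comment> \<open>Both sides are limits of \<open>X (r k) ** T (r k)\<close>: the right one
    through \<open>XT\<close>, since the shifted sequence \<open>X (r k + 1)\<close> also tends to
    \<open>Ps\<close>.\<close>
  have "Ps ** Q = mnorm (Ps ** Q) *\<^sub>R Ps"
  proof (rule LIMSEQ_unique[OF XT_lim])
    have "(\<lambda>k. X (r k + 1)) \<longlonglongrightarrow> Ps"
      using LIMSEQ_subseq_LIMSEQ[OF LIMSEQ_ignore_initial_segment[OF X_lim, of 1] r]
      by (simp add: o_def)
    with \<theta>_lim have "(\<lambda>k. \<theta> (r k) *\<^sub>R X (r k + 1)) \<longlonglongrightarrow> mnorm (Ps ** Q) *\<^sub>R Ps"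
      by (intro tendsto_intros)
    then show "(\<lambda>k. X (r k) ** T (r k)) \<longlonglongrightarrow> mnorm (Ps ** Q) *\<^sub>R Ps"
    proof (rule Lim_transform_eventually)
      show "\<forall>\<^sub>F k in sequentially. \<theta> (r k) *\<^sub>R X (r k + 1) = X (r k) ** T (r k)"
        using eventually_ge_at_top[of 1] by eventually_elim (rule XT[OF r_ge, symmetric])
    qed
  qed
  from rank_one_of_overlapping[OF Ps_nonneg Q_nonneg \<theta>_pos this J overlap Ps_nonzero]
  obtain L where L_norm: "vnorm L = 1"
    and rank1: "\<And>v. Ps *v v = (\<Sum>j\<in>UNIV. vnorm (Ps *v axis j 1) * v $ j) *\<^sub>R L"
    by blast

  \<comment> \<open>Locating n between consecutive terms of s\<close>
  have block: "\<exists>k. k \<ge> 1 \<and> s (k + 1) \<le> n \<and> n < s (k + 2)" if "s 2 \<le> n" for n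
  proof -
    have ge: "m \<le> s (m + 2)" for m
    proof (induction m)
      case (Suc m)
      then show ?case using s_less[of "m + 2" "Suc m + 2"] by simp
    qed simp
    \<comment> \<open>The hypothesis \<open>s 2 \<le> n\<close> excludes k = 0, so k - 1 is a true
      predecessor, and minimality of k gives \<open>s (k + 1) \<le> n\<close>.\<close>
    define k where "k = (LEAST k. n < s (k + 2))"
    have "n < s (Suc n + 2)" using ge[of "Suc n"] by simp
    then have k1: "n < s (k + 2)" unfolding k_def by (rule LeastI)
    have "k \<noteq> 0" using k1 that by (intro notI) (simp add: numeral_2_eq_2)
    then have "\<not> n < s (k - 1 + 2)"
      unfolding k_def by (intro not_less_Least) simp
    then have "s (k + 1) \<le> n" using \<open>k \<noteq> 0\<close> by (simp add: not_less)
    with k1 \<open>k \<noteq> 0\<close> show ?thesis by (intro exI[of _ k]) simp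
  qed
  define K where "K n = (SOME k. k \<ge> 1 \<and> s (k + 1) \<le> n \<and> n < s (k + 2))" for n
  have K: "K n \<ge> 1" "s (K n + 1) \<le> n" "n < s (K n + 2)" if "s 2 \<le> n" for n
    using someI_ex[OF block[OF that]] by (simp_all add: K_def)
  have K_lim: "filterlim K at_top sequentially"
    unfolding filterlim_at_top eventually_sequentially
  proof (intro allI exI impI)
    \<comment> \<open>The threshold is a sum so that n exceeds both \<open>s 2\<close>, which makes
      \<open>K n\<close> meaningful, and \<open>s (m + 2)\<close>, which forces \<open>K n\<close>
      to be at least m.\<close>
    fix m n assume n: "s 2 + s (m + 2) \<le> n"
    then have "s (m + 2) < s (K n + 2)" using K(3)[of n] by simp
    then have "\<not> K n + 2 < m + 2" using s_less[of "K n + 2" "m + 2"] by auto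
    then show "m \<le> K n" by simp
  qed
  have X_K: "(\<lambda>n. mnorm (X (K n) - Ps)) \<longlonglongrightarrow> 0"
  proof -
    have "(\<lambda>n. X (K n) - Ps) \<longlonglongrightarrow> 0"
      using filterlim_compose[OF X_lim K_lim] by (simp add: LIM_zero)
    from tendsto_mnorm[OF this] show ?thesis by (simp add: mnorm_def)
  qed

  \<comment> \<open>Error estimate for a fixed vector\<close>
  have main: "(\<lambda>n. (pprod A n *v c) /\<^sub>R vnorm (pprod A n *v c)) \<longlonglongrightarrow> L" if c: "c \<in> V_set A" for c
  proof -
    obtain \<gamma> where \<gamma>: "\<gamma> > 0" "\<And>n. n \<ge> 1 \<Longrightarrow> \<gamma> * mnorm (pprod A n) \<le> vnorm (pprod A n *v c)"
      using V_setE[OF c] by blast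
    have c_nonneg: "nonneg_vec c" using c by (simp add: V_set_def)
    define w where "w n = (pprod A n *v c) /\<^sub>R vnorm (pprod A n *v c)" for n
    \<comment> \<open>A bound for \<open>vnorm z\<close> below that does not depend on n: \<gamma>
      and \<delta> are what is lost when N is compared with \<open>?p * mnorm ?R\<close>.\<close>
    define C where "C = vnorm c / (\<gamma> * \<delta>)"
    have bound: "norm (w n - L) \<le> 2 * (mnorm (X (K n) - Ps) * C)" if n: "s 2 \<le> n" for n
    proof -
      let ?p = "mnorm (pprod A (s (K n)))" and ?R = "mprod A (s (K n)) n"
      define N where "N = vnorm (pprod A n *v c)"
      \<comment> \<open>Chosen so that \<open>w n = X (K n) *v z\<close>; then
        \<open>Ps *v z = \<tau> *\<^sub>R L\<close> by \<open>rank1\<close>.\<close>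
      define z where "z = (?p / N) *\<^sub>R (?R *v c)"
      define \<tau> where "\<tau> = (\<Sum>j\<in>UNIV. vnorm (Ps *v axis j 1) * z $ j)"
      have n1: "n \<ge> 1" using n s_pos[of 2] by simp
      have p_pos: "?p > 0" using P_pos s_pos[OF K(1)[OF n]] by blast
      have R: "mnorm ?R > 0" using R_pos K[OF n] by blast
      have "\<gamma> * \<delta> * (?p * mnorm ?R) \<le> \<gamma> * mnorm (pprod A n)"
        using lower[OF K[OF n]] p_pos R \<gamma>(1) by (simp add: pos_le_divide_eq mult.assoc)
      also have "\<dots> \<le> N" using \<gamma>(2)[OF n1] by (simp add: N_def)
      finally have N_ge: "\<gamma> * \<delta> * (?p * mnorm ?R) \<le> N" .
      have "0 < \<gamma> * \<delta> * (?p * mnorm ?R)" using \<gamma>(1) \<delta>_pos p_pos R by simp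
      with N_ge have N_pos: "N > 0" by linarith
      have "vnorm z \<le> (?p / N) * (mnorm ?R * vnorm c)"
        using N_pos p_pos vnorm_matrix_vector_mult_le[of ?R c]
        by (simp add: z_def vnorm_scaleR divide_right_mono)
      also have "\<dots> \<le> C"
      proof -
        have "\<gamma> * \<delta> * (?p * mnorm ?R) * vnorm c \<le> N * vnorm c"
          by (rule mult_right_mono[OF N_ge vnorm_nonneg])
        then show ?thesis using N_pos \<gamma>(1) \<delta>_pos by (simp add: C_def field_simps)
      qed
      finally have z_le: "vnorm z \<le> C" .
      have "nonneg_vec (?R *v c)"
        by (rule nonneg_vec_matrix_vector_mult[OF P_nonneg c_nonneg])
      then have \<tau>_nonneg: "\<tau> \<ge> 0"
        unfolding \<tau>_def z_def using N_pos p_pos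
        by (intro sum_nonneg mult_nonneg_nonneg vnorm_nonneg) (simp add: nonneg_vec_def)
      have w_eq: "w n = X (K n) *v z"
      proof -
        have "X (K n) *v z = (inverse ?p * (?p / N)) *\<^sub>R (pprod A n *v c)"
          by (simp only: X_def z_def scaleR_matrix_vector_mult matrix_vector_mult_scaleR
              matrix_vector_mul_assoc[symmetric] split[OF K(1,2)[OF n]] scaleR_scaleR mult.commute)
        also have "inverse ?p * (?p / N) = inverse N"
          using p_pos by (simp add: divide_inverse)
        finally show ?thesis by (simp add: w_def N_def)
      qed
      have w_norm: "vnorm (w n) = 1"
        using N_pos by (simp add: w_def vnorm_scaleR N_def)
      define e where "e = vnorm (w n - \<tau> *\<^sub>R L)"
      have "w n - \<tau> *\<^sub>R L = (X (K n) - Ps) *v z"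
        by (simp add: w_eq \<tau>_def rank1[symmetric] matrix_vector_mult_diff_rdistrib)
      then have "e \<le> mnorm (X (K n) - Ps) * vnorm z"
        unfolding e_def by (simp add: vnorm_matrix_vector_mult_le)
      also have "\<dots> \<le> mnorm (X (K n) - Ps) * C"
        by (rule mult_left_mono[OF z_le mnorm_nonneg])
      finally have e_le: "e \<le> mnorm (X (K n) - Ps) * C" .
      \<comment> \<open>Since \<open>w n\<close> and L have norm 1 and \<tau> is nonnegative, the
        two triangle inequalities give |\<tau> - 1| at most e. Replacing \<tau> by 1 therefore costs
        another e, whence the factor 2 in \<open>bound\<close>.\<close>
      have "1 \<le> e + \<tau>"
        using vnorm_triangle[of "w n - \<tau> *\<^sub>R L" "\<tau> *\<^sub>R L"] \<tau>_nonneg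
        by (simp add: e_def w_norm vnorm_scaleR L_norm)
      moreover have "\<tau> \<le> e + 1"
        using vnorm_triangle[of "\<tau> *\<^sub>R L - w n" "w n"] \<tau>_nonneg
        by (simp add: e_def w_norm vnorm_scaleR L_norm vnorm_minus_commute[of "w n" "\<tau> *\<^sub>R L"])
      ultimately have "vnorm ((\<tau> - 1) *\<^sub>R L) \<le> e"
        by (simp add: vnorm_scaleR L_norm)
      moreover have "vnorm (w n - L) \<le> e + vnorm ((\<tau> - 1) *\<^sub>R L)"
        using vnorm_triangle[of "w n - \<tau> *\<^sub>R L" "(\<tau> - 1) *\<^sub>R L"]
        by (simp add: e_def algebra_simps)
      \<comment> \<open>Convergence is in the Euclidean norm, which the entry-sum norm
        dominates.\<close>
      moreover have "norm (w n - L) \<le> vnorm (w n - L)"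
        unfolding vnorm_def by (rule norm_le_l1_cart)
      ultimately show ?thesis using e_le by simp
    qed
    have "(\<lambda>n. 2 * (mnorm (X (K n) - Ps) * C)) \<longlonglongrightarrow> 2 * (0 * C)"
      by (intro tendsto_intros X_K)
    moreover have "\<forall>\<^sub>F n in sequentially. norm (w n - L) \<le> 2 * (mnorm (X (K n) - Ps) * C)"
      using eventually_ge_at_top[of "s 2"] by eventually_elim (rule bound)
    ultimately have "(\<lambda>n. w n - L) \<longlonglongrightarrow> 0"
      by (simp add: Lim_null_comparison)
    then show ?thesis
      unfolding w_def[abs_def] by (rule LIM_zero_cancel)
  qed
  show ?thesis
  proof (intro exI[of _ L] conjI allI impI ballI)
    fix c :: "real ^ 'd" assume "pos_vec c"
    then show "(\<lambda>n. (pprod A n *v c) /\<^sub>R vnorm (pprod A n *v c)) \<longlonglongrightarrow> L"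
      by (intro main pos_vec_in_V_set nonneg nonzero)
  qed (rule main)
qed

end
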